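(* Let $f$ be the Albertson topological index. A chemical graph $G$ maximizes $f$ over all chemical graphs of the same order and size as $G$ if and only if $G\in F_{11}$.
   Context: All graphs are finite, simple and undirected. A chemical graph is a connected graph of order (number of vertices) $n\ge 7$, size (number of edges) $m\le \frac{3n-3}{2}$ and maximum degree at most $3$. For such a graph, $x_{ij}$ ($i\le j$) denotes the number of $(i,j)$-edges, i.e. edges whose endpoints have degrees $i$ and $j$ (necessarily $x_{11}=0$). A degree-based topological index is a function of the form $f(G)=c_{12}x_{12}+c_{13}x_{13}+c_{22}x_{22}+c_{23}x_{23}+c_{33}x_{33}$ with real coefficients $c_{ij}$. The Albertson index is the one with $c_{ij}=|i-j|$. $F_{11}$ is the set of chemical graphs (of order $n$ and size $m$) with $(x_{12},x_{13},x_{22},x_{23},x_{33})$ equal to - $\left(0,\frac{6n-5m}{3},0,\frac{8m-6n}{3},0\right)$ if $n-1\le m\le\frac{6n-2}{5}$ and $m\bmod 3=0$; - $\left(0,\frac{6n-5m-1}{3},1,\frac{8m-6n-2}{3},0\right)$ or $\left(1,\frac{6n-5m-4}{3},0,\frac{8m-6n+1}{3},0\right)$ or $\left(0,\frac{6n-5m+2}{3},0,\frac{8m-6n-8}{3},2\right)$ if $n-1\le m\le\frac{6n-2}{5}$ and $m\bmod 3=1$; - $\left(0,\frac{6n-5m+1}{3},0,\frac{8m-6n-4}{3},1\right)$ if $n-1\le m\le\frac{6n-2}{5}$ and $m\bmod 3=2$; - $(0,0,1,m-1,0)$ or $(0,1,0,m-3,2)$ if $m=\frac{6n-1}{5}$;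 - $(0,0,0,6n-4m,5m-6n)$ if $\frac{6n}{5}\le m\le\frac{3n-3}{2}$. *)

theory Defs
  imports Complex_Main
begin

text \<open>
  A graph is a pair of a vertex set and a set of edges, each edge being a set of two distinct
  vertices.
\<close>

type_synonym 'a graph = "'a set \<times> 'a set set"

abbreviation verts :: "'a graph \<Rightarrow> 'a set" where
  "verts \<equiv> fst"

abbreviation edges :: "'a graph \<Rightarrow> 'a set set" where
  "edges \<equiv> snd"

definition simple_graph :: "'a graph \<Rightarrow> bool" where
  "simple_graph G \<longleftrightarrow>
     finite (verts G) \<and> (\<forall>e \<in> edges G. e \<subseteq> verts G \<and> card e = 2)"

definition graph_order :: "'a graph \<Rightarrow> nat" where
  "graph_order G = card (verts G)"

definition graph_size :: "'a graph \<Rightarrow> nat" where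
  "graph_size G = card (edges G)"

definition degree :: "'a graph \<Rightarrow> 'a \<Rightarrow> nat" where
  "degree G v = card {e \<in> edges G. v \<in> e}"

definition connected_graph :: "'a graph \<Rightarrow> bool" where
  "connected_graph G \<longleftrightarrow> verts G \<noteq> {} \<and>
     (\<forall>u \<in> verts G. \<forall>v \<in> verts G. (u, v) \<in> {(x, y). {x, y} \<in> edges G}\<^sup>*)"

definition chemical_graph :: "'a graph \<Rightarrow> bool" where
  "chemical_graph G \<longleftrightarrow>
     simple_graph G \<and> connected_graph G \<and>
     graph_order G \<ge> 7 \<and>
     real (graph_size G) \<le> (3 * real (graph_order G) - 3) / 2 \<and>
     (\<forall>v \<in> verts G. degree G v \<le> 3)"

definition edge_count :: "nat \<Rightarrow> nat \<Rightarrow> 'a graph \<Rightarrow> nat" where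
  "edge_count i j G = card {e \<in> edges G. \<exists>u v. e = {u, v} \<and> degree G u = i \<and> degree G v = j}"

definition degree_based_index :: "(nat \<Rightarrow> nat \<Rightarrow> real) \<Rightarrow> 'a graph \<Rightarrow> real" where
  "degree_based_index c G =
     c 1 2 * edge_count 1 2 G + c 1 3 * edge_count 1 3 G + c 2 2 * edge_count 2 2 G +
     c 2 3 * edge_count 2 3 G + c 3 3 * edge_count 3 3 G"

definition albertson :: "'a graph \<Rightarrow> real" where
  "albertson = degree_based_index (\<lambda>i j. \<bar>real i - real j\<bar>)"

text \<open>
  The competitors \<open>H\<close> live on the same vertex type as \<open>G\<close>. Since they are finite and have as many
  vertices as \<open>G\<close>, every isomorphism class of graphs of that order is represented there.
\<close>

definition maximizes :: "('a graph \<Rightarrow> real) \<Rightarrow> 'a graph \<Rightarrow> bool" where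
  "maximizes f G \<longleftrightarrow>
     (\<forall>H. chemical_graph H \<and> graph_order H = graph_order G \<and> graph_size H = graph_size G
        \<longrightarrow> f H \<le> f G)"

text \<open>
  The edge counts are cast to reals so that the subtractions and divisions in \<open>F11\<close> are exact.
\<close>

definition edge_profile :: "'a graph \<Rightarrow> real \<times> real \<times> real \<times> real \<times> real" where
  "edge_profile G =
     (real (edge_count 1 2 G), real (edge_count 1 3 G), real (edge_count 2 2 G),
      real (edge_count 2 3 G), real (edge_count 3 3 G))"

definition F11 :: "'a graph set" where
  "F11 = {G. chemical_graph G \<and>
    (let n = real (graph_order G); m = real (graph_size G); x = edge_profile G in
      (n - 1 \<le> m \<and> m \<le> (6*n - 2) / 5 \<and> graph_size G mod 3 = 0 \<and>
         x = (0, (6*n - 5*m) / 3, 0, (8*m - 6*n) / 3, 0))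
    \<or> (n - 1 \<le> m \<and> m \<le> (6*n - 2) / 5 \<and> graph_size G mod 3 = 1 \<and>
         (x = (0, (6*n - 5*m - 1) / 3, 1, (8*m - 6*n - 2) / 3, 0)
        \<or> x = (1, (6*n - 5*m - 4) / 3, 0, (8*m - 6*n + 1) / 3, 0)
        \<or> x = (0, (6*n - 5*m + 2) / 3, 0, (8*m - 6*n - 8) / 3, 2)))
    \<or> (n - 1 \<le> m \<and> m \<le> (6*n - 2) / 5 \<and> graph_size G mod 3 = 2 \<and>
         x = (0, (6*n - 5*m + 1) / 3, 0, (8*m - 6*n - 4) / 3, 1))
    \<or> (m = (6*n - 1) / 5 \<and>
         (x = (0, 0, 1, m - 1, 0) \<or> x = (0, 1, 0, m - 3, 2)))
    \<or> (6*n / 5 \<le> m \<and> m \<le> (3*n - 3) / 2 \<and>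
         x = (0, 0, 0, 6*n - 4*m, 5*m - 6*n)))}"

end

theory Submission
  imports Defs
begin

text \<open>
  Let \<open>n\<close> be the order and \<open>m\<close> the size. Counting vertices through their incident edges, a vertex
  of degree \<open>d\<close> getting \<open>1/d\<close> from each of them, gives
  \<open>6n = 9 x12 + 8 x13 + 6 x22 + 5 x23 + 4 x33\<close>, while \<open>m\<close> is the sum of the five edge counts.
  Eliminating \<open>x13\<close> and \<open>x23\<close> from the Albertson index yields
  \<open>3 f = 6n - 2m - 2 (2 x12 + 2 x22 + x33)\<close>, so maximizing \<open>f\<close> means minimizing the
  \<^emph>\<open>defect\<close> \<open>2 x12 + 2 x22 + x33\<close>.

  The same elimination yields two constraints: \<open>x33 \<ge> 5m - 6n\<close>, because \<open>x13\<close> is nonnegative, and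
  \<open>x33\<close> is congruent to \<open>2m + x12 + x22\<close> modulo 3, because \<open>x13\<close> is an integer. They bound the
  defect from below by \<open>least_defect n m\<close> (lemma \<open>least_defect_le\<close>), and solving the constraints
  with equality gives precisely the profiles listed in \<open>F11\<close> (lemma \<open>F11_iff_least_defect\<close>).

  What remains is to realize the bound by a chemical graph of each order and size
  (lemma \<open>least_defect_attained\<close>). Put \<open>r = least_defect n m\<close>. The wanted graph has \<open>x12 = x22 = 0\<close>
  and \<open>x33 = r\<close>: a set of \<open>t = (m + r) / 3\<close> vertices of degree 3 that meets every edge and spans
  exactly \<open>r\<close> edges. It is obtained from a connected multigraph with maximum degree at most 3 on
  \<open>t\<close> vertices with \<open>q = 4t - n - r\<close> edges, by subdividing all but \<open>r\<close> of the edges (lemma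
  \<open>backbone_exists\<close>) and then hanging leaves on these \<open>t\<close> vertices until each has degree 3
  (lemma \<open>scaffold_add_leaves\<close>).
\<close>

section \<open>Double counting and connectivity\<close>

lemma finite_edges:
  assumes "simple_graph G" shows "finite (edges G)"
proof -
  have "edges G \<subseteq> Pow (verts G)" using assms by (auto simp: simple_graph_def)
  then show ?thesis using assms by (meson finite_Pow_iff finite_subset simple_graph_def)
qed

lemma edge_endpoints:
  assumes "simple_graph G" "e \<in> edges G"
  obtains u v where "e = {u, v}" "u \<noteq> v" "u \<in> verts G" "v \<in> verts G"
proof -
  have "card e = 2" "e \<subseteq> verts G" using assms by (auto simp: simple_graph_def)
  then show ?thesis using that by (auto simp: card_2_iff)
qed

lemma weighted_handshake:
  fixes g :: "'a \<Rightarrow> nat"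
  assumes "simple_graph G" "A \<subseteq> verts G"
  shows "(\<Sum>v\<in>A. g v * degree G v) = (\<Sum>e\<in>edges G. \<Sum>v\<in>e \<inter> A. g v)"
proof -
  have fin: "finite A" "finite (edges G)"
    using assms finite_edges[OF assms(1)] by (auto simp: simple_graph_def intro: finite_subset)
  have "(\<Sum>v\<in>A. g v * degree G v) = (\<Sum>v\<in>A. \<Sum>e | e \<in> edges G \<and> v \<in> e. g v)"
    by (simp add: degree_def mult.commute)
  also have "\<dots> = (\<Sum>e\<in>edges G. \<Sum>v | v \<in> A \<and> v \<in> e. g v)"
    by (rule sum.swap_restrict[OF fin])
  also have "\<dots> = (\<Sum>e\<in>edges G. \<Sum>v\<in>e \<inter> A. g v)"
    by (intro sum.cong refl) auto
  finally show ?thesis .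
qed

text \<open>
  The form in which connectivity is applied to an arbitrary chemical graph: it excludes isolated
  vertices, excludes edges between two leaves, and lets a spanning tree grow.
\<close>

lemma edge_leaving_set:
  assumes "simple_graph G" "connected_graph G" "S \<subseteq> verts G" "S \<noteq> {}" "S \<noteq> verts G"
  obtains u v where "u \<in> S" "v \<in> verts G - S" "{u, v} \<in> edges G"
proof -
  obtain s w where s: "s \<in> S" and w: "w \<in> verts G - S" using assms by blast
  have "(s, w) \<in> {(x, y). {x, y} \<in> edges G}\<^sup>*"
    using assms s w by (auto simp: connected_graph_def)
  then have "w \<notin> S \<longrightarrow> (\<exists>u\<in>S. \<exists>v. v \<notin> S \<and> {u, v} \<in> edges G)"
    by (induction rule: rtrancl_induct) (use s in auto)
  then obtain u v where "u \<in> S" "v \<notin> S" "{u, v} \<in> edges G" using w by blast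
  moreover have "v \<in> verts G"
    using assms(1) \<open>{u, v} \<in> edges G\<close> by (auto simp: simple_graph_def)
  ultimately show ?thesis using that by blast
qed

lemma connected_graphI:
  assumes "w \<in> verts G"
    and "\<And>v. v \<in> verts G \<Longrightarrow> (w, v) \<in> {(x, y). {x, y} \<in> edges G}\<^sup>*"
  shows "connected_graph G"
proof -
  let ?R = "{(x, y). {x, y} \<in> edges G}"
  have "sym (?R\<^sup>*)" by (rule sym_rtrancl) (auto simp: sym_def insert_commute)
  from rtrancl_trans[OF symD[OF this]]
  have "(u, v) \<in> ?R\<^sup>*" if "u \<in> verts G" "v \<in> verts G" for u v
    using assms(2) that by blast
  then show ?thesis using assms(1) by (auto simp: connected_graph_def)
qed

lemma connected_size_ge:
  assumes "simple_graph G" "connected_graph G"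
  shows "graph_order G \<le> graph_size G + 1"
proof -
  have fin: "finite (verts G)" "finite (edges G)"
    using assms finite_edges[OF assms(1)] by (auto simp: simple_graph_def)
  \<comment> \<open>Each edge leaving the set grown so far brings one new vertex and one new edge.\<close>
  have "\<exists>S \<subseteq> verts G. card S = Suc k \<and> k \<le> card {e \<in> edges G. e \<subseteq> S}"
    if "Suc k \<le> card (verts G)" for k
    using that
  proof (induction k)
    case 0
    obtain v where "v \<in> verts G" using assms by (auto simp: connected_graph_def)
    then show ?case by (intro exI[of _ "{v}"]) auto
  next
    case (Suc k)
    then obtain S where S: "S \<subseteq> verts G" "card S = Suc k" "k \<le> card {e \<in> edges G. e \<subseteq> S}"
      by auto
    have "S \<noteq> {}" "S \<noteq> verts G" using S Suc.prems by auto
    from edge_leaving_set[OF assms S(1) this]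
    obtain u v where uv: "u \<in> S" "v \<in> verts G - S" "{u, v} \<in> edges G" by blast
    have "insert {u, v} {e \<in> edges G. e \<subseteq> S} \<subseteq> {e \<in> edges G. e \<subseteq> insert v S}"
      using uv by auto
    then have "card (insert {u, v} {e \<in> edges G. e \<subseteq> S})
        \<le> card {e \<in> edges G. e \<subseteq> insert v S}"
      using fin by (intro card_mono) auto
    moreover have "card (insert {u, v} {e \<in> edges G. e \<subseteq> S})
        = Suc (card {e \<in> edges G. e \<subseteq> S})"
      using fin uv by (intro card_insert_disjoint) auto
    moreover have "card (insert v S) = Suc (Suc k)"
      using S uv fin by (simp add: finite_subset)
    ultimately show ?case
      using S uv by (intro exI[of _ "insert v S"]) auto
  qed
  moreover have "card (verts G) > 0"
    using assms fin by (auto simp: connected_graph_def card_gt_0_iff)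
  ultimately obtain S where "card (verts G) - 1 \<le> card {e \<in> edges G. e \<subseteq> S}"
    by (metis Suc_diff_1 order_refl)
  also have "\<dots> \<le> card (edges G)" using fin by (intro card_mono) auto
  finally show ?thesis by (simp add: graph_order_def graph_size_def)
qed

section \<open>The defect of a chemical graph\<close>

lemma chemical_degree_pos:
  assumes "chemical_graph G" "v \<in> verts G"
  shows "degree G v \<ge> 1"
proof -
  have G: "simple_graph G" "connected_graph G" "card (verts G) \<ge> 7"
    using assms by (auto simp: chemical_graph_def graph_order_def)
  have "card {v} \<noteq> card (verts G)" using G(3) by simp
  then have "{v} \<noteq> verts G" by metis
  then obtain w where "{v, w} \<in> edges G"
    using edge_leaving_set[OF G(1,2), of "{v}"] assms(2) by blast
  then have "{e \<in> edges G. v \<in> e} \<noteq> {}" by auto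
  then show ?thesis
    using finite_edges[OF G(1)] by (simp add: degree_def card_gt_0_iff Suc_le_eq)
qed

lemma chemical_no_11_edge:
  assumes "chemical_graph G" "{u, v} \<in> edges G" "degree G u = 1" "degree G v = 1"
  shows False
proof -
  have G: "simple_graph G" "connected_graph G" "card (verts G) \<ge> 7"
    using assms by (auto simp: chemical_graph_def graph_order_def)
  have uv: "{u, v} \<subseteq> verts G" using assms(2) G(1) by (auto simp: simple_graph_def)
  have "card {u, v} \<le> 2" by (simp add: card_insert_if)
  then have "{u, v} \<noteq> verts G" using G(3) by auto
  then obtain x y where xy: "x \<in> {u, v}" "y \<notin> {u, v}" "{x, y} \<in> edges G"
    using edge_leaving_set[OF G(1,2) uv] by blast
  have "card {e \<in> edges G. x \<in> e} = 1" using xy(1) assms by (auto simp: degree_def)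
  then obtain e where e: "{e \<in> edges G. x \<in> e} = {e}" by (auto simp: card_1_singleton_iff)
  have "{u, v} \<in> {e \<in> edges G. x \<in> e}" using assms(2) xy(1) by simp
  then have "{u, v} = e" unfolding e by simp
  moreover have "{x, y} \<in> {e \<in> edges G. x \<in> e}" using xy(3) by simp
  then have "{x, y} = e" unfolding e by simp
  ultimately have "y \<in> {u, v}" by blast
  then show False using xy(2) by simp
qed

text \<open>
  By the two preceding lemmas the five edge types of the index are the only ones that occur, so a
  quantity that depends only on the degrees of the endpoints can be summed type by type.
\<close>

lemma sum_over_edge_types:
  fixes c :: "nat \<Rightarrow> nat \<Rightarrow> nat"
  assumes "chemical_graph G"
    and g: "\<And>u v. {u, v} \<in> edges G \<Longrightarrow> u \<noteq> v \<Longrightarrow> degree G u \<le> degree G v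
      \<Longrightarrow> g {u, v} = c (degree G u) (degree G v)"
  shows "(\<Sum>e\<in>edges G. g e) =
      c 1 2 * edge_count 1 2 G + c 1 3 * edge_count 1 3 G + c 2 2 * edge_count 2 2 G +
      c 2 3 * edge_count 2 3 G + c 3 3 * edge_count 3 3 G"
proof -
  define T where "T i j = {e \<in> edges G. \<exists>u v. e = {u, v} \<and> degree G u = i \<and> degree G v = j}"
    for i j
  have G: "simple_graph G" using assms by (simp add: chemical_graph_def)
  have T_iff: "{u, v} \<in> T i j \<longleftrightarrow> {u, v} \<in> edges G \<and>
      (degree G u = i \<and> degree G v = j \<or> degree G u = j \<and> degree G v = i)" for u v i j
    by (auto simp: T_def doubleton_eq_iff)
  \<comment> \<open>The five types are handled through their indicator functions, one summand per type.\<close>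
  have ind: "(\<Sum>e\<in>edges G. k * of_bool (e \<in> T i j)) = k * edge_count i j G" for k i j
  proof -
    have "edges G \<inter> {e. e \<in> T i j} = T i j" by (auto simp: T_def)
    then show ?thesis
      using finite_edges[OF G]
      by (simp add: sum_distrib_left[symmetric] sum.inter_filter[symmetric] of_bool_def
          sum.If_cases edge_count_def T_def)
  qed
  have "g e = c 1 2 * of_bool (e \<in> T 1 2) + c 1 3 * of_bool (e \<in> T 1 3)
      + c 2 2 * of_bool (e \<in> T 2 2) + c 2 3 * of_bool (e \<in> T 2 3)
      + c 3 3 * of_bool (e \<in> T 3 3)" (is "_ = ?h e") if e: "e \<in> edges G" for e
  proof -
    obtain x y where xy: "e = {x, y}" "x \<noteq> y" "x \<in> verts G" "y \<in> verts G"
      using edge_endpoints[OF G e] .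
    obtain u v where uv: "e = {u, v}" "u \<noteq> v" "u \<in> verts G" "v \<in> verts G"
      "degree G u \<le> degree G v"
    proof (cases "degree G x \<le> degree G y")
      case True then show ?thesis using that xy by blast
    next
      case False
      moreover have "e = {y, x}" using xy(1) by auto
      ultimately show ?thesis using that[of y x] xy by auto
    qed
    have "degree G u \<ge> 1" "degree G v \<le> 3" "\<not> (degree G u = 1 \<and> degree G v = 1)"
      using chemical_degree_pos[OF assms(1) uv(3)] chemical_no_11_edge[OF assms(1)] uv e
        assms(1) by (auto simp: chemical_graph_def)
    then consider "degree G u = 1 \<and> degree G v = 2" | "degree G u = 1 \<and> degree G v = 3" |
      "degree G u = 2 \<and> degree G v = 2" | "degree G u = 2 \<and> degree G v = 3" |
      "degree G u = 3 \<and> degree G v = 3" using uv(5) by force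
    moreover have "g e = c (degree G u) (degree G v)" using g uv e by simp
    ultimately show ?thesis
      using e uv(1) by cases (simp_all add: T_iff)
  qed
  then have "(\<Sum>e\<in>edges G. g e) = (\<Sum>e\<in>edges G. ?h e)" by (intro sum.cong) auto
  then show ?thesis by (simp add: sum.distrib ind)
qed

lemma size_eq_edge_counts:
  assumes "chemical_graph G"
  shows "graph_size G = edge_count 1 2 G + edge_count 1 3 G + edge_count 2 2 G
    + edge_count 2 3 G + edge_count 3 3 G"
  using sum_over_edge_types[OF assms, of "\<lambda>_. 1" "\<lambda>_ _. 1"] by (simp add: graph_size_def)

text \<open>
  A vertex of degree \<open>d\<close> gives \<open>6/d\<close> to each of its edges, hence 6 in total. The degrees are
  1, 2 and 3, so the division is exact and the count can be carried out in the natural numbers.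
\<close>

lemma order_eq_edge_counts:
  assumes "chemical_graph G"
  shows "6 * graph_order G = 9 * edge_count 1 2 G + 8 * edge_count 1 3 G
    + 6 * edge_count 2 2 G + 5 * edge_count 2 3 G + 4 * edge_count 3 3 G"
proof -
  have G: "simple_graph G" using assms by (simp add: chemical_graph_def)
  have "6 div degree G v * degree G v = 6" if "v \<in> verts G" for v
  proof -
    have "degree G v \<in> {1, 2, 3}"
      using chemical_degree_pos[OF assms that] that assms by (force simp: chemical_graph_def)
    then show ?thesis by auto
  qed
  then have "6 * graph_order G = (\<Sum>v\<in>verts G. 6 div degree G v * degree G v)"
    by (simp add: graph_order_def)
  also have "\<dots> = (\<Sum>e\<in>edges G. \<Sum>v\<in>e \<inter> verts G. 6 div degree G v)"
    by (rule weighted_handshake[OF G order_refl])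
  also have "\<dots> = (\<Sum>e\<in>edges G. \<Sum>v\<in>e. 6 div degree G v)"
    using G by (intro sum.cong) (auto simp: simple_graph_def Int_absorb2)
  also have "\<dots> = 9 * edge_count 1 2 G + 8 * edge_count 1 3 G
    + 6 * edge_count 2 2 G + 5 * edge_count 2 3 G + 4 * edge_count 3 3 G"
    using sum_over_edge_types[OF assms, of "\<lambda>e. \<Sum>v\<in>e. 6 div degree G v"
        "\<lambda>i j. 6 div i + 6 div j"] by simp
  finally show ?thesis .
qed

text \<open>
  The loss against the value \<open>(6n - 2m)/3\<close>, which the Albertson index takes when every edge joins a
  vertex of degree 3 to one of degree 1 or 2; the unit is \<open>2/3\<close>.
\<close>

definition defect :: "'a graph \<Rightarrow> nat" where
  "defect G = 2 * edge_count 1 2 G + 2 * edge_count 2 2 G + edge_count 3 3 G"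

lemma albertson_eq_defect:
  assumes "chemical_graph G"
  shows "3 * albertson G = 6 * real (graph_order G) - 2 * real (graph_size G) - 2 * real (defect G)"
proof -
  have "6 * real (graph_order G) = real (6 * graph_order G)" by simp
  also have "\<dots> = 9 * real (edge_count 1 2 G) + 8 * real (edge_count 1 3 G)
    + 6 * real (edge_count 2 2 G) + 5 * real (edge_count 2 3 G) + 4 * real (edge_count 3 3 G)"
    unfolding order_eq_edge_counts[OF assms] by simp
  finally show ?thesis
    by (simp add: albertson_def degree_based_index_def defect_def size_eq_edge_counts[OF assms])
qed

text \<open>
  When \<open>6n \<le> 5m\<close> there are too many edges for degree 3 vertices to avoid each other, and the excess
  \<open>5m - 6n\<close> must be made of 33-edges. Otherwise only a divisibility obstruction survives: \<open>2m mod 3\<close>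
  is the least \<open>x33\<close> that the congruence allows when \<open>x12 = x22 = 0\<close>, and one
  12-edge or 22-edge already costs 2, the largest possible value of \<open>2m mod 3\<close>.
\<close>

definition least_defect :: "nat \<Rightarrow> nat \<Rightarrow> nat" where
  "least_defect n m = (if 6 * n \<le> 5 * m then 5 * m - 6 * n else (2 * m) mod 3)"

lemma order_size_balance:
  assumes "chemical_graph G"
  shows "6 * graph_order G + edge_count 3 3 G
    = 5 * graph_size G + 4 * edge_count 1 2 G + 3 * edge_count 1 3 G + edge_count 2 2 G"
  using size_eq_edge_counts[OF assms] order_eq_edge_counts[OF assms] by linarith

lemma edge_count_33_mod_3:
  assumes "chemical_graph G"
  shows "edge_count 3 3 G mod 3
    = (2 * graph_size G + edge_count 1 2 G + edge_count 2 2 G) mod 3"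
proof -
  have "edge_count 3 3 G + 3 * (2 * graph_order G)
      = 2 * graph_size G + edge_count 1 2 G + edge_count 2 2 G
        + 3 * (graph_size G + edge_count 1 2 G + edge_count 1 3 G)"
    using order_size_balance[OF assms] by (simp add: algebra_simps)
  then show ?thesis by (metis mod_mult_self2)
qed

lemma least_defect_le:
  assumes "chemical_graph G"
  shows "least_defect (graph_order G) (graph_size G) \<le> defect G"
proof (cases "6 * graph_order G \<le> 5 * graph_size G")
  case True
  then show ?thesis
    using order_size_balance[OF assms] by (simp add: least_defect_def defect_def)
next
  case False
  have "2 * graph_size G mod 3 \<le> defect G"
  proof (cases "edge_count 1 2 G = 0 \<and> edge_count 2 2 G = 0")
    case True
    then show ?thesis
      using edge_count_33_mod_3[OF assms] by (simp add: defect_def)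
  next
    case False
    then have "2 \<le> defect G" by (auto simp: defect_def)
    moreover have "2 * graph_size G mod 3 < 3" by simp
    ultimately show ?thesis by linarith
  qed
  then show ?thesis using False by (simp add: least_defect_def)
qed

lemma F11_iff_least_defect:
  assumes "chemical_graph G"
  shows "G \<in> F11 \<longleftrightarrow> defect G = least_defect (graph_order G) (graph_size G)"
proof -
  define n m where nm: "n = graph_order G" "m = graph_size G"
  define a b c d e where x: "a = edge_count 1 2 G" "b = edge_count 1 3 G"
    "c = edge_count 2 2 G" "d = edge_count 2 3 G" "e = edge_count 3 3 G"
  have id: "m = a + b + c + d + e" "6 * n = 9 * a + 8 * b + 6 * c + 5 * d + 4 * e"
    using size_eq_edge_counts[OF assms] order_eq_edge_counts[OF assms] by (simp_all add: nm x)
  have bal: "6 * n + e = 5 * m + 4 * a + 3 * b + c" using id by linarith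
  have bnd: "n \<le> m + 1" "2 * m + 3 \<le> 3 * n"
    using connected_size_ge[of G] assms by (auto simp: chemical_graph_def nm)
  \<comment> \<open>The two counting identities determine \<open>x13\<close> and \<open>x23\<close>, so in each profile of \<open>F11\<close> the
    entries for 12-, 22- and 33-edges imply the other two.\<close>
  have rid: "real m = a + b + c + d + e" "6 * real n = 9 * a + 8 * b + 6 * c + 5 * d + 4 * e"
    using id(1) arg_cong[OF id(2), of real] by simp_all
  have c1: "real n - 1 \<le> m" using bnd by simp
  have c2: "real m \<le> (6 * real n - 2) / 5 \<longleftrightarrow> 5 * m + 2 \<le> 6 * n" by auto
  have c3: "real m = (6 * real n - 1) / 5 \<longleftrightarrow> 5 * m + 1 = 6 * n" by auto
  have c4: "6 * real n / 5 \<le> real m \<longleftrightarrow> 6 * n \<le> 5 * m" by auto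
  have c5: "real m \<le> (3 * real n - 3) / 2" using bnd by simp
  have p0: "(real a, real b, real c, real d, real e)
      = (0, (6 * real n - 5 * real m) / 3, 0, (8 * real m - 6 * real n) / 3, 0)
      \<longleftrightarrow> a = 0 \<and> c = 0 \<and> e = 0" using rid by auto
  have p1: "(real a, real b, real c, real d, real e)
      = (0, (6 * real n - 5 * real m - 1) / 3, 1, (8 * real m - 6 * real n - 2) / 3, 0)
      \<longleftrightarrow> a = 0 \<and> c = 1 \<and> e = 0" using rid by auto
  have p2: "(real a, real b, real c, real d, real e)
      = (1, (6 * real n - 5 * real m - 4) / 3, 0, (8 * real m - 6 * real n + 1) / 3, 0)
      \<longleftrightarrow> a = 1 \<and> c = 0 \<and> e = 0" using rid by auto
  have p3: "(real a, real b, real c, real d, real e)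
      = (0, (6 * real n - 5 * real m + 2) / 3, 0, (8 * real m - 6 * real n - 8) / 3, 2)
      \<longleftrightarrow> a = 0 \<and> c = 0 \<and> e = 2" using rid by auto
  have p4: "(real a, real b, real c, real d, real e)
      = (0, (6 * real n - 5 * real m + 1) / 3, 0, (8 * real m - 6 * real n - 4) / 3, 1)
      \<longleftrightarrow> a = 0 \<and> c = 0 \<and> e = 1" using rid by auto
  have p5: "(real a, real b, real c, real d, real e) = (0, 0, 1, real m - 1, 0)
      \<longleftrightarrow> a = 0 \<and> b = 0 \<and> c = 1 \<and> e = 0" using rid by auto
  have p6: "(real a, real b, real c, real d, real e) = (0, 1, 0, real m - 3, 2)
      \<longleftrightarrow> a = 0 \<and> b = 1 \<and> c = 0 \<and> e = 2" using rid by auto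
  have p7: "(real a, real b, real c, real d, real e)
      = (0, 0, 0, 6 * real n - 4 * real m, 5 * real m - 6 * real n)
      \<longleftrightarrow> a = 0 \<and> b = 0 \<and> c = 0" using rid by auto
  have "G \<in> F11 \<longleftrightarrow>
      (5 * m + 2 \<le> 6 * n \<and> m mod 3 = 0 \<and> a = 0 \<and> c = 0 \<and> e = 0)
    \<or> (5 * m + 2 \<le> 6 * n \<and> m mod 3 = 1 \<and>
        (a = 0 \<and> c = 1 \<and> e = 0 \<or> a = 1 \<and> c = 0 \<and> e = 0 \<or> a = 0 \<and> c = 0 \<and> e = 2))
    \<or> (5 * m + 2 \<le> 6 * n \<and> m mod 3 = 2 \<and> a = 0 \<and> c = 0 \<and> e = 1)
    \<or> (5 * m + 1 = 6 * n \<and>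
        (a = 0 \<and> b = 0 \<and> c = 1 \<and> e = 0 \<or> a = 0 \<and> b = 1 \<and> c = 0 \<and> e = 2))
    \<or> (6 * n \<le> 5 * m \<and> a = 0 \<and> b = 0 \<and> c = 0)"
    unfolding F11_def edge_profile_def Let_def mem_Collect_eq nm[symmetric] x[symmetric]
      c2 c3 c4 p0 p1 p2 p3 p4 p5 p6 p7 using assms c1 c5 by simp
  also have "\<dots> \<longleftrightarrow> 2 * a + 2 * c + e = least_defect n m"
  proof (cases "6 * n \<le> 5 * m")
    case True
    then have "least_defect n m = 5 * m - 6 * n" by (simp add: least_defect_def)
    then show ?thesis using True bal by auto
  next
    case False
    \<comment> \<open>The three ways to have defect 2 are the three profiles for \<open>m mod 3 = 1\<close>.\<close>
    have two: "2 * a + 2 * c + e = 2 \<longleftrightarrow>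
        a = 0 \<and> c = 1 \<and> e = 0 \<or> a = 1 \<and> c = 0 \<and> e = 0 \<or> a = 0 \<and> c = 0 \<and> e = 2"
      by (cases a; cases c) auto
    have one: "2 * a + 2 * c + e = 1 \<longleftrightarrow> a = 0 \<and> c = 0 \<and> e = 1"
      by (cases a; cases c) auto
    show ?thesis
    proof (cases "5 * m + 1 = 6 * n")
      case True
      \<comment> \<open>Here \<open>1 + x33 = 4 x12 + 3 x13 + x22\<close>, which excludes the profile with a 12-edge.\<close>
      then have "m mod 3 = 1" by presburger
      then have "least_defect n m = 2" using False by (simp add: least_defect_def) presburger
      then show ?thesis unfolding \<open>least_defect n m = 2\<close> two using True bal by auto
    next
      case gap: False
      have "m mod 3 = 0 \<or> m mod 3 = 1 \<or> m mod 3 = 2" by linarith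
      then show ?thesis
      proof (elim disjE)
        assume m: "m mod 3 = 0"
        then have "2 * m mod 3 = 0" by presburger
        then have l: "least_defect n m = 0" using False by (simp add: least_defect_def)
        show ?thesis unfolding l using m False gap by auto
      next
        assume m: "m mod 3 = 1"
        then have "2 * m mod 3 = 2" by presburger
        then have l: "least_defect n m = 2" using False by (simp add: least_defect_def)
        show ?thesis unfolding l two using m False gap by auto
      next
        assume m: "m mod 3 = 2"
        then have "2 * m mod 3 = 1" by presburger
        then have l: "least_defect n m = 1" using False by (simp add: least_defect_def)
        show ?thesis unfolding l one using m False gap by auto
      qed
    qed
  qed
  finally show ?thesis by (simp add: defect_def nm x)
qed

section \<open>Scaffolds\<close>

text \<open>
  The vertices in \<open>C\<close>, the \<^emph>\<open>centers\<close>, are meant to become the vertices of degree 3, and \<open>r\<close> counts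
  the edges between centers. Only upper bounds on degrees are required, so the property survives
  the attachment of leaves, and the exact degrees come for free at the end: once
  \<open>m + r = 3 |C|\<close>, the degree sum over \<open>C\<close> forces every center to have degree 3.
\<close>

definition scaffold :: "nat \<Rightarrow> 'a set \<Rightarrow> 'a graph \<Rightarrow> bool" where
  "scaffold r C G \<longleftrightarrow>
     simple_graph G \<and> connected_graph G \<and> C \<subseteq> verts G \<and>
     (\<forall>v\<in>C. degree G v \<le> 3) \<and> (\<forall>v\<in>verts G - C. degree G v \<le> 2) \<and>
     (\<forall>e\<in>edges G. e \<inter> C \<noteq> {}) \<and> card {e \<in> edges G. e \<subseteq> C} = r"

lemma scaffold_degree_sum:
  assumes "scaffold r C G"
  shows "(\<Sum>v\<in>C. degree G v) = graph_size G + r"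
proof -
  have G: "simple_graph G" "C \<subseteq> verts G" "\<forall>e\<in>edges G. e \<inter> C \<noteq> {}"
      "card {e \<in> edges G. e \<subseteq> C} = r"
    using assms by (auto simp: scaffold_def)
  have "(\<Sum>v\<in>C. degree G v) = (\<Sum>e\<in>edges G. card (e \<inter> C))"
    using weighted_handshake[OF G(1,2), of "\<lambda>_. 1"] by simp
  also have "\<dots> = (\<Sum>e\<in>edges G. of_bool (e \<subseteq> C) + 1)"
  proof (intro sum.cong refl)
    fix e assume e: "e \<in> edges G"
    obtain u v where uv: "e = {u, v}" "u \<noteq> v" using edge_endpoints[OF G(1) e] by metis
    have "e \<inter> C \<noteq> {}" using G(3) e by blast
    then have "u \<in> C \<or> v \<in> C" using uv(1) by simp
    then show "card (e \<inter> C) = of_bool (e \<subseteq> C) + 1"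
      using uv by (cases "u \<in> C"; cases "v \<in> C") simp_all
  qed
  also have "\<dots> = graph_size G + r"
    using finite_edges[OF G(1)] G(4)
    by (subst sum.distrib) (simp add: graph_size_def of_bool_def sum.If_cases Int_def)
  finally show ?thesis .
qed

text \<open>
  All centers have degree 3 by the degree sum and all other vertices have smaller degree. Since every
  edge meets \<open>C\<close>, there are no 12-edges or 22-edges, and a 33-edge lies inside \<open>C\<close>.
\<close>

lemma scaffold_defect_le:
  assumes S: "scaffold r C G" and sat: "graph_size G + r = 3 * card C"
  shows "defect G \<le> r"
proof -
  have G: "simple_graph G" "C \<subseteq> verts G" "\<forall>e\<in>edges G. e \<inter> C \<noteq> {}"
      "\<forall>v\<in>C. degree G v \<le> 3" "\<forall>v\<in>verts G - C. degree G v \<le> 2"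
      "card {e \<in> edges G. e \<subseteq> C} = r"
    using S by (auto simp: scaffold_def)
  have finC: "finite C" using G(1,2) by (auto simp: simple_graph_def intro: finite_subset)
  have "degree G v = 3" if v: "v \<in> C" for v
  proof (rule ccontr)
    assume "degree G v \<noteq> 3"
    then have "degree G v < 3" using bspec[OF G(4) v] by simp
    then have "(\<Sum>v\<in>C. degree G v) < (\<Sum>v\<in>C. 3)"
      using finC G(4) v by (intro sum_strict_mono_ex1) auto
    then show False using scaffold_degree_sum[OF S] sat by simp
  qed
  then have deg3: "v \<in> C \<longleftrightarrow> degree G v = 3" if "v \<in> verts G" for v
    using G(5) that by force
  have sub: "{u, v} \<subseteq> verts G" if "{u, v} \<in> edges G" for u v
    using G(1) that by (auto simp: simple_graph_def)
  have low: "edge_count i j G = 0" if "i \<noteq> 3" "j \<noteq> 3" for i j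
  proof -
    have False if "{u, v} \<in> edges G" "degree G u = i" "degree G v = j" for u v
    proof -
      have "{u, v} \<inter> C \<noteq> {}" using G(3) that(1) by blast
      then have "u \<in> C \<or> v \<in> C" by simp
      then show False using deg3[of u] deg3[of v] sub[OF that(1)] that \<open>i \<noteq> 3\<close> \<open>j \<noteq> 3\<close> by auto
    qed
    then have "{e \<in> edges G. \<exists>u v. e = {u, v} \<and> degree G u = i \<and> degree G v = j} = {}"
      by blast
    then show ?thesis unfolding edge_count_def by (simp only: card.empty)
  qed
  have "e \<subseteq> C" if "e \<in> edges G" "e = {u, v}" "degree G u = 3" "degree G v = 3" for e u v
    using sub[of u v] deg3[of u] deg3[of v] that by simp
  then have "{e \<in> edges G. \<exists>u v. e = {u, v} \<and> degree G u = 3 \<and> degree G v = 3}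
      \<subseteq> {e \<in> edges G. e \<subseteq> C}" by blast
  then have "edge_count 3 3 G \<le> card {e \<in> edges G. e \<subseteq> C}"
    unfolding edge_count_def using finite_edges[OF G(1)] by (intro card_mono) simp_all
  then show ?thesis using G(6) low by (simp add: defect_def)
qed

text \<open>As long as \<open>m + r < 3 |C|\<close>, the degree sum provides a center with a free slot for a leaf.\<close>

lemma scaffold_add_leaf:
  assumes S: "scaffold r C G" and room: "graph_size G + r < 3 * card C" and x: "x \<notin> verts G"
  shows "\<exists>H. scaffold r C H \<and> verts H = insert x (verts G) \<and> graph_size H = Suc (graph_size G)"
proof -
  have G: "simple_graph G" "connected_graph G" "C \<subseteq> verts G" "\<forall>e\<in>edges G. e \<inter> C \<noteq> {}"
      "\<forall>v\<in>C. degree G v \<le> 3" "\<forall>v\<in>verts G - C. degree G v \<le> 2"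
      "card {e \<in> edges G. e \<subseteq> C} = r"
    using S by (auto simp: scaffold_def)
  have "\<exists>v\<in>C. degree G v < 3"
  proof (rule ccontr)
    assume "\<not> ?thesis"
    then have "(\<Sum>v\<in>C. 3) \<le> (\<Sum>v\<in>C. degree G v)" by (intro sum_mono) auto
    then show False using scaffold_degree_sum[OF S] room by simp
  qed
  then obtain v where v: "v \<in> C" "degree G v < 3" by blast
  define H where "H = (insert x (verts G), insert {v, x} (edges G))"
  have fin: "finite (edges G)" using finite_edges[OF G(1)] .
  have x_edge: "x \<notin> e" if "e \<in> edges G" for e
    using G(1) x that by (auto simp: simple_graph_def)
  have vx: "v \<noteq> x" "v \<in> verts G" using v G(3) x by auto
  have new: "{v, x} \<notin> edges G" using x_edge by blast
  have simp_H: "simple_graph H" using G(1) vx by (auto simp: H_def simple_graph_def)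
  have deg: "degree H u = degree G u + of_bool (u = v)" if "u \<noteq> x" for u
  proof (cases "u = v")
    case True
    have "{e \<in> edges H. v \<in> e} = insert {v, x} {e \<in> edges G. v \<in> e}" by (auto simp: H_def)
    then show ?thesis using True fin new by (simp add: degree_def)
  next
    case False
    then have "{e \<in> edges H. u \<in> e} = {e \<in> edges G. u \<in> e}" using that by (auto simp: H_def)
    then show ?thesis using False by (simp add: degree_def)
  qed
  have degx: "degree H x = 1"
  proof -
    have "{e \<in> edges H. x \<in> e} = {{v, x}}" using x_edge by (auto simp: H_def)
    then show ?thesis by (simp add: degree_def)
  qed
  have conn: "connected_graph H"
  proof (rule connected_graphI)
    show "v \<in> verts H" using vx by (simp add: H_def)
    fix w assume "w \<in> verts H"
    then consider "w = x" | "w \<in> verts G" by (auto simp: H_def)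
    then show "(v, w) \<in> {(x, y). {x, y} \<in> edges H}\<^sup>*"
    proof cases
      case 1 then show ?thesis by (auto simp: H_def)
    next
      case 2
      then have "(v, w) \<in> {(x, y). {x, y} \<in> edges G}\<^sup>*"
        using G(2) vx by (auto simp: connected_graph_def)
      moreover have "{(x, y). {x, y} \<in> edges G} \<subseteq> {(x, y). {x, y} \<in> edges H}"
        by (auto simp: H_def)
      ultimately show ?thesis using rtrancl_mono by blast
    qed
  qed
  have "{e \<in> edges H. e \<subseteq> C} = {e \<in> edges G. e \<subseteq> C}" using G(3) x by (auto simp: H_def)
  moreover have "degree H u \<le> 3" if "u \<in> C" for u
  proof -
    have "u \<noteq> x" using that G(3) x by blast
    then show ?thesis using deg[of u] that v G(5) by (cases "u = v") auto
  qed
  moreover have "degree H u \<le> 2" if "u \<in> verts H - C" for u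
    using deg[of u] degx that v G(6) by (cases "u = x") (auto simp: H_def)
  ultimately have "scaffold r C H"
    using simp_H conn G(3,4,7) v unfolding scaffold_def by (auto simp: H_def)
  moreover have "graph_size H = Suc (graph_size G)" using fin new by (simp add: H_def graph_size_def)
  ultimately show ?thesis by (intro exI[of _ H]) (simp add: H_def)
qed

text \<open>
  The vertices are natural numbers here so that a fresh one is always at hand.
\<close>

lemma scaffold_add_leaves:
  fixes G :: "nat graph"
  assumes "scaffold r C G" "graph_size G + r + k \<le> 3 * card C"
  shows "\<exists>H :: nat graph. scaffold r C H \<and> graph_order H = graph_order G + k
    \<and> graph_size H = graph_size G + k"
  using assms(2)
proof (induction k)
  case 0
  then show ?case using assms(1) by (intro exI[of _ G]) simp
next
  case (Suc k)
  then obtain H :: "nat graph" where H: "scaffold r C H" "graph_order H = graph_order G + k"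
    "graph_size H = graph_size G + k" by auto
  have fin: "finite (verts H)" using H(1) by (simp add: scaffold_def simple_graph_def)
  obtain x where "x \<notin> verts H" using ex_new_if_finite[OF infinite_UNIV_nat fin] by blast
  then obtain K where K: "scaffold r C K" "verts K = insert x (verts H)"
    "graph_size K = Suc (graph_size H)"
    using scaffold_add_leaf[OF H(1), of x] H(3) Suc.prems by auto
  then have "graph_order K = Suc (graph_order H)"
    using fin \<open>x \<notin> verts H\<close> by (simp add: graph_order_def)
  then show ?case using K H by (intro exI[of _ K]) simp
qed

text \<open>
  Competitors of a graph must live on its vertex type, which may be finite; this lemma carries over a
  scaffold built on the natural numbers.
\<close>

lemma scaffold_relabel:
  assumes S: "scaffold r C G" and inj: "inj_on f (verts G)"
  shows "\<exists>H D. scaffold r D H \<and> verts H = f ` verts G \<and> graph_size H = graph_size G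
    \<and> card D = card C"
proof -
  define H where "H = (f ` verts G, (`) f ` edges G)"
  have G: "simple_graph G" "connected_graph G" "C \<subseteq> verts G" "\<forall>e\<in>edges G. e \<inter> C \<noteq> {}"
      "\<forall>v\<in>C. degree G v \<le> 3" "\<forall>v\<in>verts G - C. degree G v \<le> 2"
      "card {e \<in> edges G. e \<subseteq> C} = r"
    using S by (auto simp: scaffold_def)
  have sub: "e \<subseteq> verts G" if "e \<in> edges G" for e using G(1) that by (auto simp: simple_graph_def)
  have "edges G \<subseteq> Pow (verts G)" using sub by auto
  then have injE: "inj_on ((`) f) (edges G)"
    using inj_on_image_Pow[OF inj] inj_on_subset by blast
  have simp_H: "simple_graph H"
    using G(1) inj by (auto simp: H_def simple_graph_def card_image inj_on_subset)
  have deg: "degree H (f v) = degree G v" if v: "v \<in> verts G" for v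
  proof -
    have "{e \<in> edges H. f v \<in> e} = (`) f ` {e \<in> edges G. v \<in> e}"
      using inj_on_image_mem_iff[OF inj v sub] by (auto simp: H_def)
    then show ?thesis
      unfolding degree_def by (simp add: card_image inj_on_subset[OF injE])
  qed
  have conn: "connected_graph H"
  proof -
    have "(f u, f v) \<in> {(x, y). {x, y} \<in> edges H}\<^sup>*" if "u \<in> verts G" "v \<in> verts G" for u v
    proof -
      have edge: "{f x, f y} \<in> edges H" if "{x, y} \<in> edges G" for x y
      proof -
        have "f ` {x, y} \<in> edges H" using that unfolding H_def by (simp del: image_insert)
        then show ?thesis by simp
      qed
      have "(u, v) \<in> {(x, y). {x, y} \<in> edges G}\<^sup>*"
        using G(2) that by (simp add: connected_graph_def)
      then show ?thesis
      proof (induction rule: rtrancl_induct)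
        case base
        show ?case by simp
      next
        case (step y z)
        then show ?case using edge[of y z]
          by (auto intro: rtrancl_into_rtrancl)
      qed
    qed
    then show ?thesis using G(2) by (auto simp: connected_graph_def H_def)
  qed
  have "f ` e \<subseteq> f ` C \<longleftrightarrow> e \<subseteq> C" if "e \<in> edges G" for e
    using inj_on_image_mem_iff[OF inj _ G(3)] sub[OF that] by blast
  then have "{e \<in> edges H. e \<subseteq> f ` C} = (`) f ` {e \<in> edges G. e \<subseteq> C}"
    by (auto simp: H_def)
  then have inner: "card {e \<in> edges H. e \<subseteq> f ` C} = r"
    using G(7) by (simp add: card_image inj_on_subset[OF injE])
  have "scaffold r (f ` C) H"
    unfolding scaffold_def
  proof (intro conjI ballI)
    fix w assume "w \<in> verts H - f ` C"
    then obtain v where "w = f v" "v \<in> verts G - C" by (auto simp: H_def)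
    then show "degree H w \<le> 2" using deg G(6) by simp
  next
    fix w assume "w \<in> f ` C"
    then show "degree H w \<le> 3" using deg G(3,5) by auto
  next
    fix e assume "e \<in> edges H"
    then obtain d where "d \<in> edges G" "e = f ` d" by (auto simp: H_def)
    then show "e \<inter> f ` C \<noteq> {}" using G(4) by blast
  next
    show "f ` C \<subseteq> verts H" using G(3) by (auto simp: H_def)
  qed (fact simp_H conn inner)+
  moreover have "graph_size H = graph_size G"
    using card_image[OF injE] by (simp add: H_def graph_size_def)
  moreover have "card (f ` C) = card C" using inj G(3) by (metis card_image inj_on_subset)
  ultimately show ?thesis by (auto simp: H_def)
qed

section \<open>The backbone\<close>

text \<open>
  The multigraph before subdivision has vertices \<open>0, ..., t - 1\<close>, and its edge number \<open>j\<close> joins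
  \<open>tail_end t j\<close> to \<open>head_end t j\<close>. Edges \<open>0, ..., t - 1\<close> form the Hamiltonian cycle in cyclic order,
  and edge \<open>t + i\<close> is the chord from \<open>i\<close> to its opposite vertex \<open>i + \<lceil>t/2\<rceil>\<close>; with all
  chords present and \<open>t\<close> even this is the Moebius ladder. Taking the first \<open>q\<close> edges
  gives every size from a spanning path up to \<open>3t/2\<close>.
\<close>

definition tail_end :: "nat \<Rightarrow> nat \<Rightarrow> nat" where
  "tail_end t j = (if j < t then j else j - t)"

definition head_end :: "nat \<Rightarrow> nat \<Rightarrow> nat" where
  "head_end t j =
    (if j + 1 < t then j + 1 else if j + 1 = t then 0 else j - t + (t + 1) div 2)"

text \<open>
  For \<open>t \<ge> 4\<close> the multigraph has no parallel edges. For \<open>t = 2\<close> and \<open>t = 3\<close> it can have some, but the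
  first \<open>t - 1\<close> edges form a path. The first \<open>r\<close> edges are those that stay undivided, so they are the
  ones that must be distinct.
\<close>

lemma backbone_ends_inj:
  assumes ij: "i < r" "j < r" and r: "r \<le> q" "r < t \<or> 4 \<le> t" "2 * q \<le> 3 * t"
    and eq: "tail_end t i = tail_end t j \<and> head_end t i = head_end t j
      \<or> tail_end t i = head_end t j \<and> head_end t i = tail_end t j"
  shows "i = j"
proof -
  define h where "h = (t + 1) div 2"
  have h: "t \<le> 2 * h" "2 * h \<le> t + 1" by (auto simp: h_def)
  have ends: "k + 1 < t \<and> tail_end t k = k \<and> head_end t k = k + 1
      \<or> k + 1 = t \<and> tail_end t k = k \<and> head_end t k = 0
      \<or> k \<ge> t \<and> tail_end t k + t = k \<and> head_end t k = tail_end t k + h" for k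
    by (auto simp: tail_end_def head_end_def h_def)
  show ?thesis
    using eq
  proof
    assume "tail_end t i = tail_end t j \<and> head_end t i = head_end t j"
    then show ?thesis using ends[of i] ends[of j] ij r h by linarith
  next
    assume "tail_end t i = head_end t j \<and> head_end t i = tail_end t j"
    then show ?thesis using ends[of i] ends[of j] ij r h by linarith
  qed
qed

text \<open>
  The first \<open>r\<close> edges of the multigraph are kept, and every later edge \<open>j\<close> is replaced by a path of
  length 2 through a new vertex \<open>t + j\<close>. Subdivision removes parallel edges, keeps the graph connected
  and leaves exactly the \<open>r\<close> undivided edges inside the set of centers.
\<close>

lemma backbone_exists:
  assumes t: "2 \<le> t" "t \<le> q + 1" "2 * q \<le> 3 * t" and r: "r \<le> q" "r < t \<or> 4 \<le> t"
  shows "\<exists>G :: nat graph. scaffold r {..<t} G \<and> graph_order G = t + (q - r)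
    \<and> graph_size G = r + 2 * (q - r)"
proof -
  let ?a = "tail_end t" and ?b = "head_end t"
  have ab: "?a j < t" "?b j < t" "?a j \<noteq> ?b j" if "j < q" for j
    using that t by (auto simp: tail_end_def head_end_def)
  have rq: "j < q" if "j < r" for j using that r by simp
  define P where "P = (\<lambda>j. {?a j, ?b j}) ` {..<r}"
  define A where "A = (\<lambda>j. {?a j, t + j}) ` {r..<q}"
  define B where "B = (\<lambda>j. {?b j, t + j}) ` {r..<q}"
  define G where "G = ({..<t} \<union> {t + r..<t + q}, P \<union> A \<union> B)"
  have verts_G: "verts G = {..<t} \<union> {t + r..<t + q}" and edges_G: "edges G = P \<union> A \<union> B"
    by (simp_all add: G_def)
  have simp_G: "simple_graph G"
  proof -
    have "{?a j, ?b j} \<subseteq> verts G \<and> card {?a j, ?b j} = 2" if "j \<in> {..<r}" for j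
      using ab[OF rq, of j] that by (auto simp: verts_G)
    moreover have "{?a j, t + j} \<subseteq> verts G \<and> card {?a j, t + j} = 2
        \<and> {?b j, t + j} \<subseteq> verts G \<and> card {?b j, t + j} = 2" if "j \<in> {r..<q}" for j
      using ab[of j] that by (auto simp: verts_G card_insert_if)
    ultimately have "e \<subseteq> verts G \<and> card e = 2" if "e \<in> P \<union> A \<union> B" for e
      using that unfolding P_def A_def B_def by (elim UnE imageE) (simp_all only:)
    moreover have "finite (verts G)" by (simp add: verts_G)
    ultimately show ?thesis unfolding simple_graph_def edges_G by blast
  qed
  have card_P: "card P = r"
  proof -
    have "inj_on (\<lambda>j. {?a j, ?b j}) {..<r}"
    proof (rule inj_onI)
      fix i j assume "i \<in> {..<r}" "j \<in> {..<r}" "{?a i, ?b i} = {?a j, ?b j}"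
      then have "i < r" "j < r" "?a i = ?a j \<and> ?b i = ?b j \<or> ?a i = ?b j \<and> ?b i = ?a j"
        by (auto simp: doubleton_eq_iff)
      then show "i = j" using backbone_ends_inj[of i r j q t] t r by blast
    qed
    then show ?thesis by (simp add: P_def card_image)
  qed
  have card_AB: "card A = q - r" "card B = q - r"
  proof -
    have "inj_on (\<lambda>j. {?a j, t + j}) {r..<q}" "inj_on (\<lambda>j. {?b j, t + j}) {r..<q}"
      using ab by (intro inj_onI; fastforce simp: doubleton_eq_iff)+
    then show "card A = q - r" "card B = q - r" by (simp_all add: A_def B_def card_image)
  qed
  have size: "card (edges G) = r + 2 * (q - r)"
  proof -
    have "P \<inter> (A \<union> B) = {}"
    proof -
      have "e \<subseteq> {..<t}" if "e \<in> P" for e using that ab rq by (auto simp: P_def)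
      moreover have "\<not> e \<subseteq> {..<t}" if "e \<in> A \<union> B" for e using that by (auto simp: A_def B_def)
      ultimately show ?thesis by blast
    qed
    moreover have "A \<inter> B = {}"
    proof -
      have "{?a i, t + i} \<noteq> {?b j, t + j}" if "i \<in> {r..<q}" "j \<in> {r..<q}" for i j
        using ab[of i] ab[of j] that by (auto simp: doubleton_eq_iff)
      then show ?thesis unfolding A_def B_def by blast
    qed
    moreover have "finite P" "finite A" "finite B" by (simp_all add: P_def A_def B_def)
    ultimately show ?thesis
      using card_P card_AB by (simp add: edges_G Un_assoc card_Un_disjoint)
  qed
  have center_deg: "degree G v \<le> 3" if v: "v \<in> {..<t}" for v
  proof -
    define h where "h = (\<lambda>j. if j < r then {?a j, ?b j} else {v, t + j})"
    \<comment> \<open>A vertex lies on at most three edges of the multigraph: the two cycle edges at \<open>v\<close>, numbered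
      \<open>v\<close> and \<open>v - 1\<close> (cyclically), and one chord. The chord starts at \<open>v\<close> if \<open>v\<close> is in the first half
      and ends there otherwise. The map \<open>h\<close> sends each of them to the edge at \<open>v\<close> that it becomes.\<close>
    define J where "J = {v, if v = 0 then t - 1 else v - 1,
      if v < (t + 1) div 2 then v + t else v + t - (t + 1) div 2}"
    have J: "j \<in> J" if "j < q" "v = ?a j \<or> v = ?b j" for j
      using that t v unfolding J_def tail_end_def head_end_def by (auto split: if_splits)
    have "{e \<in> edges G. v \<in> e} \<subseteq> h ` J"
    proof
      fix e assume "e \<in> {e \<in> edges G. v \<in> e}"
      then have e: "e \<in> P \<union> A \<union> B" "v \<in> e" by (auto simp: edges_G)
      then consider j where "j < r" "e = {?a j, ?b j}" | j where "r \<le> j" "j < q" "e = {?a j, t + j}"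
        | j where "r \<le> j" "j < q" "e = {?b j, t + j}"
        by (auto simp: P_def A_def B_def)
      then show "e \<in> h ` J"
      proof cases
        case (1 j)
        then have "j \<in> J" using J[of j] rq e(2) by auto
        then show ?thesis using 1 by (auto simp: h_def)
      next
        case (2 j)
        then have "v = ?a j" using e(2) v by auto
        then show ?thesis using 2 J[of j] by (auto simp: h_def)
      next
        case (3 j)
        then have "v = ?b j" using e(2) v by auto
        then show ?thesis using 3 J[of j] by (auto simp: h_def)
      qed
    qed
    moreover have "finite J" "card J \<le> 3" by (auto simp: J_def card_insert_if)
    ultimately show ?thesis
      unfolding degree_def by (meson card_image_le card_mono finite_imageI le_trans)
  qed
  have sub_deg: "degree G v \<le> 2" if v: "v \<in> verts G - {..<t}" for v
  proof -
    have "{e \<in> edges G. v \<in> e} \<subseteq> {{?a (v - t), v}, {?b (v - t), v}}"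
    proof
      fix e assume e: "e \<in> {e \<in> edges G. v \<in> e}"
      have "e \<notin> P" using e v ab rq by (fastforce simp: P_def)
      then obtain j where j: "r \<le> j" "j < q" "e = {?a j, t + j} \<or> e = {?b j, t + j}"
        using e by (auto simp: edges_G A_def B_def)
      then have "v = t + j" using e v ab[of j] by auto
      then show "e \<in> {{?a (v - t), v}, {?b (v - t), v}}" using j by auto
    qed
    then have "degree G v \<le> card {{?a (v - t), v}, {?b (v - t), v}}"
      unfolding degree_def by (intro card_mono) auto
    also have "\<dots> \<le> 2" by (simp add: card_insert_if)
    finally show ?thesis .
  qed
  have conn: "connected_graph G"
  proof (rule connected_graphI)
    show "0 \<in> verts G" using t by (simp add: verts_G)
    let ?R = "{(x, y). {x, y} \<in> edges G}"
    have step: "(?a j, ?b j) \<in> ?R\<^sup>*" if "j < q" for j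
    proof (cases "j < r")
      case True then show ?thesis by (auto simp: edges_G P_def)
    next
      case False
      then have "(?a j, t + j) \<in> ?R" "(t + j, ?b j) \<in> ?R"
        using that by (auto simp: edges_G A_def B_def insert_commute)
      then show ?thesis by (meson converse_rtrancl_into_rtrancl r_into_rtrancl)
    qed
    have center: "(0, i) \<in> ?R\<^sup>*" if "i < t" for i
      using that
    proof (induction i)
      case 0 then show ?case by simp
    next
      case (Suc i)
      have "(i, Suc i) \<in> ?R\<^sup>*"
        using step[of i] Suc.prems t by (simp add: tail_end_def head_end_def)
      then show ?case using Suc by (meson Suc_lessD rtrancl_trans)
    qed
    fix v assume "v \<in> verts G"
    then consider "v < t" | j where "v = t + j" "r \<le> j" "j < q"
      unfolding verts_G by (auto simp: le_iff_add)
    then show "(0, v) \<in> ?R\<^sup>*"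
    proof cases
      case 1 then show ?thesis by (rule center)
    next
      case (2 j)
      then have "(?a j, v) \<in> ?R" by (auto simp: edges_G A_def)
      then show ?thesis using center[OF ab(1)[OF 2(3)]] by (rule rtrancl_into_rtrancl[rotated])
    qed
  qed
  have "{e \<in> edges G. e \<subseteq> {..<t}} = P"
    using ab rq by (auto simp: edges_G P_def A_def B_def)
  moreover have "e \<inter> {..<t} \<noteq> {}" if "e \<in> edges G" for e
    using that ab rq by (fastforce simp: edges_G P_def A_def B_def)
  ultimately have "scaffold r {..<t} G"
    using simp_G conn center_deg sub_deg card_P unfolding scaffold_def by (auto simp: verts_G)
  moreover have "graph_order G = t + (q - r)"
  proof -
    have "{..<t} \<inter> {t + r..<t + q} = {}" by auto
    then show ?thesis by (simp add: graph_order_def verts_G card_Un_disjoint)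
  qed
  ultimately show ?thesis using size by (intro exI[of _ G]) (simp add: graph_size_def)
qed

section \<open>Existence of extremal graphs\<close>

text \<open>
  The equations say that the scaffold with \<open>t\<close> centers, \<open>q\<close> multigraph edges and \<open>3t - 2q\<close> leaves has
  order \<open>4t - q - r\<close> and size \<open>3t - r\<close>; the inequalities make it exist. In the dense case
  \<open>6n \<le> 5m\<close> there are no leaves and the multigraph is cubic on \<open>2(m - n)\<close> vertices. In the sparse case
  \<open>n \<le> m + 1\<close> is what makes \<open>q\<close> large enough for a spanning path.
\<close>

lemma extremal_parameters:
  assumes "7 \<le> n" "n \<le> m + 1" "2 * m + 3 \<le> 3 * n" and r: "r = least_defect n m"
  obtains t q where "m + r = 3 * t" "n + q + r = 4 * t" "2 \<le> t" "t \<le> q + 1" "2 * q \<le> 3 * t"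
    "r \<le> q" "r < t \<or> 4 \<le> t"
proof (cases "6 * n \<le> 5 * m")
  case True
  then have "r = 5 * m - 6 * n" using r by (simp add: least_defect_def)
  moreover obtain k where "m = n + k" using True le_Suc_ex[of n m] by auto
  ultimately show ?thesis using that[of "2 * k" "3 * k"] assms True by auto
next
  case False
  then have r3: "r = 2 * m mod 3" using r by (simp add: least_defect_def)
  define t where "t = (m + r) div 3"
  have "(m + r) mod 3 = 0" unfolding r3 by presburger
  then have t: "m + r = 3 * t" unfolding t_def by presburger
  have r2: "r \<le> 2" using r3 by simp
  \<comment> \<open>Two centers occur only for \<open>m = 6\<close>, where nothing stays undivided.\<close>
  have "m = 6 \<Longrightarrow> r = 0" "m = 7 \<Longrightarrow> r = 2" using r3 by auto
  then have "2 \<le> t" "r < t" using t r2 assms by auto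
  then show ?thesis using that[of t "4 * t - n - r"] t r2 assms False by auto
qed

lemma least_defect_attained:
  fixes G :: "'a graph"
  assumes "chemical_graph G"
  shows "\<exists>H :: 'a graph. chemical_graph H \<and> graph_order H = graph_order G
    \<and> graph_size H = graph_size G \<and> defect H \<le> least_defect (graph_order G) (graph_size G)"
proof -
  define n m r where nm: "n = graph_order G" "m = graph_size G" and r: "r = least_defect n m"
  have G: "simple_graph G" "connected_graph G" "7 \<le> n" "real m \<le> (3 * real n - 3) / 2"
    using assms by (auto simp: chemical_graph_def nm)
  have "2 * m + 3 \<le> 3 * n" using G(4) by simp
  then obtain t q where tq: "m + r = 3 * t" "n + q + r = 4 * t" "2 \<le> t" "t \<le> q + 1"
    "2 * q \<le> 3 * t" "r \<le> q" "r < t \<or> 4 \<le> t"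
    using extremal_parameters[OF G(3) _ _ r] connected_size_ge[OF G(1,2)]
    unfolding nm by metis
  obtain B :: "nat graph" where B: "scaffold r {..<t} B" "graph_order B = t + (q - r)"
    "graph_size B = r + 2 * (q - r)"
    using backbone_exists[OF tq(3-7)] by blast
  have "graph_size B + r + (3 * t - 2 * q) \<le> 3 * card {..<t}" using B(3) tq by simp
  from scaffold_add_leaves[OF B(1) this]
  obtain K :: "nat graph" where K: "scaffold r {..<t} K"
    "graph_order K = graph_order B + (3 * t - 2 * q)"
    "graph_size K = graph_size B + (3 * t - 2 * q)" by blast
  have order_K: "graph_order K = n" and size_K: "graph_size K = m" using K B tq by auto
  have "finite (verts K)" "finite (verts G)"
    using K(1) G(1) by (auto simp: scaffold_def simple_graph_def)
  then obtain f where "bij_betw f (verts K) (verts G)"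
    using order_K finite_same_card_bij[of "verts K" "verts G"] by (auto simp: graph_order_def nm)
  then have f: "inj_on f (verts K)" "f ` verts K = verts G" by (auto simp: bij_betw_def)
  obtain H :: "'a graph" and D where H: "scaffold r D H" "verts H = verts G" "graph_size H = m"
    "card D = t"
    using scaffold_relabel[OF K(1) f(1)] f(2) size_K by auto
  have "defect H \<le> r" using scaffold_defect_le[OF H(1)] H tq by simp
  moreover have "graph_order H = n" using H(2) by (simp add: graph_order_def nm)
  moreover have "degree H v \<le> 3" if "v \<in> verts H" for v
  proof (cases "v \<in> D")
    case True
    then show ?thesis using H(1) by (simp add: scaffold_def)
  next
    case False
    then have "degree H v \<le> 2" using H(1) that by (simp add: scaffold_def)
    then show ?thesis by simp
  qed
  moreover have "simple_graph H" "connected_graph H" using H(1) by (simp_all add: scaffold_def)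
  ultimately show ?thesis
    using H(3) G(3,4) by (intro exI[of _ H]) (simp add: chemical_graph_def nm r)
qed

theorem theorem22:
  fixes G :: "'a graph"
  assumes "chemical_graph G"
  shows "maximizes albertson G \<longleftrightarrow> G \<in> F11"
proof -
  let ?r = "least_defect (graph_order G) (graph_size G)"
  have compare: "albertson H \<le> albertson G \<longleftrightarrow> defect G \<le> defect H"
    if "chemical_graph H" "graph_order H = graph_order G" "graph_size H = graph_size G"
    for H :: "'a graph"
    using albertson_eq_defect[OF assms] albertson_eq_defect[OF that(1)] that(2,3) by auto
  have "maximizes albertson G \<longleftrightarrow> defect G = ?r"
  proof
    assume "maximizes albertson G"
    moreover obtain H :: "'a graph" where H: "chemical_graph H" "graph_order H = graph_order G"
      "graph_size H = graph_size G" "defect H \<le> ?r"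
      using least_defect_attained[OF assms] by blast
    ultimately have "albertson H \<le> albertson G" unfolding maximizes_def by blast
    then have "defect G \<le> defect H" using compare[OF H(1-3)] by simp
    then show "defect G = ?r" using H(4) least_defect_le[OF assms] by simp
  next
    assume "defect G = ?r"
    then show "maximizes albertson G"
      unfolding maximizes_def using compare least_defect_le by metis
  qed
  then show ?thesis using F11_iff_least_defect[OF assms] by simp
qed

end
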